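(* Assume the setting described in the context, and let $\langle e^m_\alpha:\alpha<\lambda,m<\omega\rangle$ be a generalized $C$-sequence on $\lambda$ such that for all $\alpha<\lambda$ and $m<\omega$: $|e^m_\alpha|\leq\mathrm{cf}(\alpha)+\mu_m^+$, and if $\delta\in S\cap e^m_\alpha$ then $C_\delta[m]\subseteq e^m_\alpha$. Let $\langle t_\alpha:\alpha<\lambda\rangle$ be a pairwise disjoint family of finite subsets of $\lambda$. Then for $\mathrm{id}_p(\bar C,\bar I)$-almost all $\beta^*<\lambda$ (that is, the set of $\beta^*<\lambda$ for which the following fails belongs to $\mathrm{id}_p(\bar C,\bar I)$) there are $\alpha<\beta<\lambda$ and $m<\omega$ such that for every $\zeta\in t_\alpha$ and $\xi\in t_\beta$, the $m$-walk from $\xi$ to $\zeta$ passes through $\beta^*$, i.e. $\beta^*=\beta^m_k(\zeta,\xi)$ for some $k$.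
   Context: Setting: $\mu$ is a singular cardinal with $\mathrm{cf}(\mu)=\aleph_0$, $\lambda=\mu^+$, $\sigma$ is a regular cardinal with $\aleph_0<\sigma<\mu$, $S$ is a stationary subset of $\{\delta<\lambda:\mathrm{cf}(\delta)=\sigma\}$, and $\langle\mu_i:i<\omega\rangle$ is a strictly increasing sequence of regular cardinals cofinal in $\mu$ with $\sigma<\mu_0$. For each $\delta\in S$, $c^0_\delta$ is the increasing enumeration of a closed unbounded subset of $\delta$ of order type $\sigma$, and for every club $E\subseteq\lambda$ the set of $\delta\in S$ with $\mathrm{ran}(c^0_\delta)\subseteq E$ is stationary. For $\delta\in S$, $\epsilon<\sigma$, $m<\omega$, $I(\delta,\epsilon,m)$ is the half-open interval $(c^0_\delta(\omega\cdot\epsilon+m),c^0_\delta(\omega\cdot\epsilon+m+1)]$. $\bar C=\langle C_\delta:\delta\in S\rangle$ satisfies: $C_\delta$ is closed unbounded in $\delta$; $\mathrm{ran}(c^0_\delta)\subseteq C_\delta$; $|C_\delta\cap I(\delta,\epsilon,m)|\leq\mu_m^+$; every $\alpha\in\mathrm{nacc}(C_\delta)\cap I(\delta,\epsilon,m)$ has $\mathrm{cf}(\alpha)>\mu_m^+$; for every club $E\subseteq\lambda$ there are stationarily many $\delta\in S$ such that $E\cap\mathrm{nacc}(C_\delta)\cap I(\delta,\epsilon,m)\neq\emptyset$ for all $\epsilon<\sigma$, $m<\omega$. Here for $C$ club in $\delta$, $\mathrm{acc}(C)=\{\alpha<\delta:\alpha=\sup(\alpha\cap C)\}$, $\mathrm{nacc}(C)=C\setminus\mathrm{acc}(C)$.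 For $\delta\in S$, $I_\delta$ is the ideal on $C_\delta$ generated by the sets $\{\gamma\in C_\delta:\gamma\in\mathrm{acc}(C_\delta)\text{ or }\mathrm{cf}(\gamma)<\alpha\text{ or }\gamma<\beta\}$ for $\alpha<\mu$, $\beta<\delta$; $\mathrm{id}_p(\bar C,\bar I)$ is the ideal of all $A\subseteq\lambda$ for which there is a club $E\subseteq\lambda$ with $A\cap E\cap C_\delta\in I_\delta$ for all $\delta\in S\cap E$. $C_\delta[m]=\mathrm{ran}(c^0_\delta)\cup\bigcup\{C_\delta\cap I(\delta,\epsilon,i):\epsilon<\sigma, i\leq m\}$. A generalized $C$-sequence on $\lambda$ is a family $\langle e^m_\alpha:\alpha<\lambda,m<\omega\rangle$ with each $e^m_\alpha$ closed unbounded in $\alpha$ and $e^m_\alpha\subseteq e^{m+1}_\alpha$. Walks: for $\alpha<\beta<\lambda$ and $m<\omega$, $\beta^m_0(\alpha,\beta)=\beta$ and $\beta^m_{i+1}(\alpha,\beta)=\min(e^m_{\beta^m_i(\alpha,\beta)}\setminus\alpha)$ if $\beta^m_i(\alpha,\beta)>\alpha$, and $=\alpha$ otherwise; $\rho^m_2(\alpha,\beta)$ is the least $i$ with $\beta^m_i(\alpha,\beta)=\alpha$; the $m$-walk from $\beta$ to $\alpha$ is $\langle\beta^m_i(\alpha,\beta):i\leq\rho^m_2(\alpha,\beta)\rangle$. *)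

theory Defs
  imports Main
begin

text \<open>Ordinals below lambda are modelled as the elements of a well-ordered type 'a;
  an ordinal a is identified with its set of predecessors seg a.\<close>

definition seg :: "'a::wellorder \<Rightarrow> 'a set" where
  "seg a = {x. x < a}"

definition is_card :: "'a::wellorder \<Rightarrow> bool" where
  "is_card a \<longleftrightarrow> (\<forall>b<a. ordLess2 (card_of (seg b)) (card_of (seg a)))"

definition cofinal_in :: "'a::wellorder set \<Rightarrow> 'a \<Rightarrow> bool" where
  "cofinal_in X a \<longleftrightarrow> (\<forall>y<a. \<exists>x\<in>X. y \<le> x)"

definition cf :: "'a::wellorder \<Rightarrow> 'a" where
  "cf a = (LEAST b. \<exists>X. X \<subseteq> seg a \<and> cofinal_in X a \<and> ordIso2 (card_of X) (card_of (seg b)))"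

definition csuc :: "'a::wellorder \<Rightarrow> 'a" where
  "csuc k = (LEAST b. ordLess2 (card_of (seg k)) (card_of (seg b)))"

definition osucc :: "'a::wellorder \<Rightarrow> 'a" where
  "osucc x = (LEAST y. x < y)"

definition lim_pt :: "'a::wellorder set \<Rightarrow> 'a \<Rightarrow> bool" where
  "lim_pt C a \<longleftrightarrow> (\<exists>g\<in>C. g < a) \<and> (\<forall>b<a. \<exists>g\<in>C. b < g \<and> g < a)"

definition acc :: "'a::wellorder set \<Rightarrow> 'a set" where
  "acc C = {a. lim_pt C a}"

definition nacc :: "'a::wellorder set \<Rightarrow> 'a set" where
  "nacc C = C - acc C"

definition club_in :: "'a::wellorder \<Rightarrow> 'a set \<Rightarrow> bool" where
  "club_in d C \<longleftrightarrow> C \<subseteq> seg d \<and> (\<forall>b<d. \<exists>g\<in>C. b \<le> g) \<and> (\<forall>a<d. lim_pt C a \<longrightarrow> a \<in> C)"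

definition club :: "'a::wellorder set \<Rightarrow> bool" where
  "club E \<longleftrightarrow> (\<forall>b. \<exists>g\<in>E. b \<le> g) \<and> (\<forall>a. lim_pt E a \<longrightarrow> a \<in> E)"

definition stationary :: "'a::wellorder set \<Rightarrow> bool" where
  "stationary S \<longleftrightarrow> (\<forall>E. club E \<longrightarrow> S \<inter> E \<noteq> {})"

text \<open>finite part: g = (osucc ^^ fin g) b with b zero or limit, i.e. g = omega * eps + fin g\<close>
definition fin :: "'a::wellorder \<Rightarrow> nat" where
  "fin g = (LEAST n. \<exists>b. (seg b = {} \<or> lim_pt UNIV b) \<and> (osucc ^^ n) b = g)"

text \<open>the interval I(d, eps, m) = (c0_d(g), c0_d(g+1)] where g = omega*eps+m\<close>
definition Ivl :: "('a::wellorder \<Rightarrow> 'a \<Rightarrow> 'a) \<Rightarrow> 'a \<Rightarrow> 'a \<Rightarrow> 'a set" where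
  "Ivl c0 d g = {x. c0 d g < x \<and> x \<le> c0 d (osucc g)}"

definition Cm :: "'a::wellorder \<Rightarrow> ('a \<Rightarrow> 'a \<Rightarrow> 'a) \<Rightarrow> ('a \<Rightarrow> 'a set) \<Rightarrow> 'a \<Rightarrow> nat \<Rightarrow> 'a set" where
  "Cm sigma c0 C d m = c0 d ` seg sigma \<union> \<Union>{C d \<inter> Ivl c0 d g | g. g < sigma \<and> fin g \<le> m}"

definition gen_ideal :: "'b set \<Rightarrow> 'b set set \<Rightarrow> 'b set set" where
  "gen_ideal X G = {A. A \<subseteq> X \<and> (\<exists>F. finite F \<and> F \<subseteq> G \<and> A \<subseteq> \<Union>F)}"

definition Id :: "'a::wellorder \<Rightarrow> ('a \<Rightarrow> 'a set) \<Rightarrow> 'a \<Rightarrow> 'a set set" where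
  "Id mu C d = gen_ideal (C d)
     {{g \<in> C d. g \<in> acc (C d) \<or> cf g < a \<or> g < b} | a b. a < mu \<and> b < d}"

definition idp :: "'a::wellorder \<Rightarrow> 'a set \<Rightarrow> ('a \<Rightarrow> 'a set) \<Rightarrow> 'a set set" where
  "idp mu S C = {A. \<exists>E. club E \<and> (\<forall>d\<in>S \<inter> E. A \<inter> E \<inter> C d \<in> Id mu C d)}"

definition gen_C_seq :: "(nat \<Rightarrow> 'a::wellorder \<Rightarrow> 'a set) \<Rightarrow> bool" where
  "gen_C_seq e \<longleftrightarrow> (\<forall>m a. club_in a (e m a) \<and> e m a \<subseteq> e (Suc m) a)"

primrec walk :: "(nat \<Rightarrow> 'a::wellorder \<Rightarrow> 'a set) \<Rightarrow> nat \<Rightarrow> 'a \<Rightarrow> 'a \<Rightarrow> nat \<Rightarrow> 'a" where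
  "walk e m a b 0 = b"
| "walk e m a b (Suc i) =
     (if a < walk e m a b i then (LEAST x. x \<in> e m (walk e m a b i) \<and> a \<le> x) else a)"

end

theory Submission
  imports Defs
begin

text \<open>Let \<open>E\<close> be the club of all \<open>x\<close> such that below \<open>x\<close> there are \<open>t\<^sub>a\<close> with \<open>a < x\<close> arbitrarily
  close to \<open>x\<close>. Fix \<open>d \<in> S\<close> and \<open>b \<ge> d\<close> with \<open>t\<^sub>b\<close> above \<open>d\<close>. For \<open>x \<in> t\<^sub>b\<close> the \<open>m\<close>-walk from \<open>x\<close>
  towards \<open>d\<close> does not depend on \<open>m\<close> once \<open>m \<ge> N\<close>, and for targets in a final segment of \<open>d\<close> it
  reaches a point \<open>w\<close> with \<open>d \<in> e\<^sup>m\<^sub>w\<close>, so \<open>C\<^sub>d[m] \<subseteq> e\<^sup>m\<^sub>w\<close>. A point \<open>\<beta> \<in> E \<inter> nacc(C\<^sub>d)\<close> in that segment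
  lies in some \<open>I(d,\<epsilon>,i)\<close>, and \<open>m = max N i\<close> gives \<open>\<beta> \<in> C\<^sub>d[m]\<close>. If \<open>cf \<beta>\<close> exceeds \<open>cf w\<close> and
  \<open>\<mu>\<^sub>N\<^sup>+\<close>, it exceeds \<open>|e\<^sup>m\<^sub>w|\<close>, so \<open>e\<^sup>m\<^sub>w\<close> is bounded below \<open>\<beta>\<close> and the \<open>m\<close>-walk from \<open>x\<close> to any
  target just below \<open>\<beta>\<close> steps from \<open>w\<close> to \<open>\<beta>\<close>; since \<open>\<beta> \<in> E\<close>, some \<open>t\<^sub>a\<close> consists of such targets.
  All conditions on \<open>\<beta>\<close> other than \<open>\<beta> \<in> E\<close> hold modulo \<open>I\<^sub>d\<close>.\<close>

unbundle cardinal_syntax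

section \<open>Cardinality and cofinality of ordinals represented by initial segments\<close>

lemma seg_mono: "a \<le> b \<Longrightarrow> seg a \<subseteq> seg b"
  by (auto simp: seg_def)

lemma seg_card_mono: "a \<le> b \<Longrightarrow> |seg a| \<le>o |seg b|"
  by (intro card_of_mono1 seg_mono)

text \<open>The minimal well-order \<open>|X|\<close> embeds into the order of \<open>seg a\<close>
  onto an initial part, which is the segment below the least point it omits. So every cofinal subset
  of \<open>seg a\<close> yields a candidate for the \<open>LEAST\<close> in
  \<open>cf\<close>.\<close>

lemma ex_seg_card:
  fixes a :: "'a::wellorder"
  assumes X: "X \<subseteq> seg a"
  shows "\<exists>b::'a. |X| =o |seg b|"
proof -
  define r where "r = {(x, y). x \<le> y \<and> y < a}"
  have field: "Field r = seg a"
    by (auto simp: r_def Field_def seg_def Domain_iff Range_iff)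
  have "wf (r - Relation.Id)"
    by (rule wf_subset[OF wf]) (auto simp: r_def)
  then have wo: "Well_order r"
    unfolding well_order_on_def linear_order_on_def partial_order_on_def preorder_on_def
      field refl_on_def total_on_def antisym_def trans_def
    by (auto simp: r_def seg_def)
  have "|X| \<le>o |seg a|" using X by (rule card_of_mono1)
  also have "|seg a| \<le>o r" using card_of_least[OF wo] unfolding field .
  finally obtain f where f: "embed |X| r f" unfolding ordLeq_def by blast
  have inj: "inj_on f X"
    using embed_inj_on[OF card_of_Well_order f] by (simp add: Field_card_of)
  have "wo_rel.ofilter r (f ` X)"
    using embed_Field_ofilter[OF card_of_Well_order wo f] by (simp add: Field_card_of)
  then have fil: "f ` X \<subseteq> seg a" "\<forall>x\<in>f ` X. under r x \<subseteq> f ` X"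
    using wo field by (auto simp: wo_rel.ofilter_def wo_rel_def)
  have down: "x \<in> f ` X" if "y \<in> f ` X" "x \<le> y" for x y
  proof -
    have "x \<in> under r y" using that fil(1) by (auto simp: under_def r_def seg_def)
    then show ?thesis using fil(2) that(1) by blast
  qed
  define b where "b = (LEAST y. y \<notin> f ` X)"
  have "a \<notin> f ` X" using fil(1) by (auto simp: seg_def)
  then have b: "b \<notin> f ` X" unfolding b_def by (rule LeastI)
  have "f ` X = seg b"
  proof (intro equalityI subsetI)
    fix x assume "x \<in> f ` X"
    with b down have "\<not> b \<le> x" by blast
    then show "x \<in> seg b" by (simp add: seg_def)
  next
    fix x assume "x \<in> seg b"
    then show "x \<in> f ` X"
      using not_less_Least[of x "\<lambda>y. y \<notin> f ` X"] by (auto simp: seg_def b_def)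
  qed
  with inj have "bij_betw f X (seg b)" by (simp add: bij_betw_def)
  then show ?thesis using card_of_ordIso by blast
qed

lemma cf_le_card:
  fixes a :: "'a::wellorder"
  assumes X: "X \<subseteq> seg a" "cofinal_in X a"
  shows "|seg (cf a)| \<le>o |X|"
proof -
  obtain b :: 'a where b: "|X| =o |seg b|" using ex_seg_card[OF X(1)] by blast
  have "cf a \<le> b" unfolding cf_def by (rule Least_le) (use X b in blast)
  then have "|seg (cf a)| \<le>o |seg b|" by (rule seg_card_mono)
  then show ?thesis using b ordIso_symmetric ordLeq_ordIso_trans by blast
qed

lemma cf_attained: "\<exists>X. X \<subseteq> seg a \<and> cofinal_in X a \<and> |X| =o |seg (cf a)|"
  unfolding cf_def
  by (rule LeastI[of _ a]) (auto intro!: exI[of _ "seg a"] simp: cofinal_in_def seg_def card_of_refl)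

lemma bounded_if_small:
  assumes "X \<subseteq> seg a" "|X| <o |seg (cf a)|"
  shows "\<exists>y<a. \<forall>x\<in>X. x < y"
proof (rule ccontr)
  assume "\<not> ?thesis"
  then have "cofinal_in X a" unfolding cofinal_in_def by (meson linorder_not_less)
  then show False using cf_le_card[OF assms(1)] assms(2) not_ordLess_ordLeq by blast
qed

text \<open>A smaller \<open>b\<close> of the same size would itself be a candidate in the
  \<open>LEAST\<close> defining \<open>cf a\<close>.\<close>

lemma is_card_cf: "is_card (cf a)"
  unfolding is_card_def
proof (intro allI impI)
  fix b assume b: "b < cf a"
  show "|seg b| <o |seg (cf a)|"
  proof (rule ccontr)
    assume "\<not> |seg b| <o |seg (cf a)|"
    then have "|seg (cf a)| \<le>o |seg b|"
      using ordLess_or_ordLeq card_of_Well_order by blast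
    moreover have "|seg b| \<le>o |seg (cf a)|" using b by (intro seg_card_mono) simp
    ultimately have "|seg (cf a)| =o |seg b|" using ordIso_iff_ordLeq by blast
    moreover obtain X where "X \<subseteq> seg a" "cofinal_in X a" "|X| =o |seg (cf a)|"
      using cf_attained by blast
    ultimately have "cf a \<le> b"
      unfolding cf_def by (intro Least_le) (blast intro: ordIso_transitive)
    with b show False by simp
  qed
qed

lemma is_card_less: "is_card a \<Longrightarrow> b < a \<Longrightarrow> |seg b| <o |seg a|"
  by (simp add: is_card_def)

lemma seq_bounded:
  fixes f :: "nat \<Rightarrow> 'a::wellorder"
  assumes "|UNIV :: nat set| <o |seg (cf d)|" "\<And>n. f n < d"
  shows "\<exists>y<d. \<forall>n. f n < y"
proof -
  have "range f \<subseteq> seg d" using assms(2) by (auto simp: seg_def)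
  moreover have "|range f| <o |seg (cf d)|"
    using card_of_image assms(1) ordLeq_ordLess_trans by blast
  ultimately show ?thesis using bounded_if_small[of "range f" d] by auto
qed

text \<open>A cofinal set of size \<open>mu\<close> would be a countable union of smaller, hence bounded, sets.\<close>

lemma cf_less_if_countable_cofinality:
  fixes mu :: "'a::wellorder" and mus :: "nat \<Rightarrow> 'a"
  assumes mu: "is_card mu" "|UNIV :: nat set| <o |seg mu|"
    and mus: "\<And>i. mus i < mu" "\<And>b. b < mu \<Longrightarrow> \<exists>i. b < mus i"
    and small: "|seg a| \<le>o |seg mu|"
  shows "cf a < mu"
proof (rule ccontr)
  assume "\<not> cf a < mu"
  then have "mu \<le> cf a" by simp
  obtain X where X: "X \<subseteq> seg a" "cofinal_in X a" "|X| =o |seg (cf a)|"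
    using cf_attained by blast
  have "|seg (cf a)| \<le>o |seg a|"
    by (rule cf_le_card) (auto simp: cofinal_in_def seg_def)
  then have "|seg (cf a)| \<le>o |seg mu|" using small by (rule ordLeq_transitive)
  then have "\<not> mu < cf a"
    using is_card_less[OF is_card_cf] not_ordLess_ordLeq by blast
  with \<open>mu \<le> cf a\<close> have cf: "cf a = mu" by simp
  obtain f where f: "bij_betw f (seg mu) X"
    using X(3) cf card_of_ordIso ordIso_symmetric by metis
  have "\<exists>y<a. \<forall>x\<in>f ` seg (mus i). x < y" for i
  proof (rule bounded_if_small)
    show "f ` seg (mus i) \<subseteq> seg a"
      using f X(1) seg_mono[OF less_imp_le[OF mus(1)[of i]]] unfolding bij_betw_def by blast
    show "|f ` seg (mus i)| <o |seg (cf a)|"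
      using card_of_image is_card_less[OF mu(1) mus(1)[of i]] ordLeq_ordLess_trans
      unfolding cf by blast
  qed
  then obtain y where y: "\<And>i. y i < a" "\<And>i x. x \<in> f ` seg (mus i) \<Longrightarrow> x < y i"
    by metis
  obtain z where z: "z < a" "\<And>i. y i < z"
    using seq_bounded[of a y] mu(2) y(1) unfolding cf by blast
  then obtain x where x: "x \<in> X" "z \<le> x" using X(2) unfolding cofinal_in_def by blast
  then obtain u where "u < mu" "x = f u" using f by (auto simp: bij_betw_def seg_def)
  moreover then obtain i where "u < mus i" using mus(2) by blast
  ultimately have "x < y i" by (intro y) (auto simp: seg_def)
  with z(2)[of i] x(2) show False by simp
qed

lemma csuc_le: "|seg k| <o |seg (b::'a::wellorder)| \<Longrightarrow> csuc k \<le> b"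
  unfolding csuc_def by (rule Least_le)

text \<open>\<open>csuc\<close> is a least element taken within the type, so it is a genuine
  successor only if some segment there is larger; \<open>b\<close> witnesses this.\<close>

lemma csuc_card: "|seg (k::'a::wellorder)| <o |seg (b::'a)| \<Longrightarrow> |seg k| <o |seg (csuc k)|"
  unfolding csuc_def by (rule LeastI)

section \<open>Walks and their dependence on \<open>m\<close>\<close>

text \<open>The recursion of \<open>walk\<close> appends the last step, while an induction on the
  starting point has to peel off the first one.\<close>

lemma walk_Suc_shift: "walk e m z x (Suc k) = walk e m z (walk e m z x 1) k"
  by (induction k) auto

lemma gen_C_seq_mono:
  assumes "gen_C_seq e" "m \<le> n"
  shows "e m a \<subseteq> e n a"
  using assms lift_Suc_mono_le[of "\<lambda>m. e m a"] by (auto simp: gen_C_seq_def)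

text \<open>Since the \<open>e m x\<close> increase with \<open>m\<close>, each step of the \<open>m\<close>-walk from \<open>x\<close> to \<open>d\<close> is
  eventually constant in \<open>m\<close>; the suprema of the sets \<open>e m x\<close> below \<open>d\<close> are bounded
  simultaneously for all \<open>m\<close> because \<open>d\<close> has uncountable cofinality.\<close>

lemma walk_stabilizes:
  fixes e :: "nat \<Rightarrow> 'a::wellorder \<Rightarrow> 'a set"
  assumes e: "gen_C_seq e"
    and bnd: "\<And>f::nat \<Rightarrow> 'a. (\<And>n. f n < d) \<Longrightarrow> \<exists>y<d. \<forall>n. f n < y"
    and y0: "y0 < d"
  shows "d < x \<Longrightarrow> \<exists>M k b g. g < d \<and> d < b \<and>
    (\<forall>m\<ge>M. d \<in> e m b \<and> (\<forall>z. g < z \<and> z < d \<longrightarrow> walk e m z x k = b))"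
proof (induction x rule: less_induct)
  case (less x)
  have e_club: "club_in a (e m a)" for a m using e by (simp add: gen_C_seq_def)
  show ?case
  proof (cases "\<exists>M. d \<in> e M x")
    case True
    then obtain M where "d \<in> e M x" by blast
    then have "\<forall>m\<ge>M. d \<in> e m x" using gen_C_seq_mono[OF e] by blast
    with y0 less.prems show ?thesis by (intro exI[of _ M] exI[of _ 0]) auto
  next
    case False
    define P where "P m y \<longleftrightarrow> y \<in> e m x \<and> d \<le> y" for m y
    define w where "w m = (LEAST y. P m y)" for m
    have "\<exists>y. P m y" for m
      using e_club[of x m] less.prems unfolding club_in_def P_def by blast
    then have w: "P m (w m)" for m unfolding w_def by (metis LeastI)
    \<comment> \<open>The first steps \<open>w m\<close> towards \<open>d\<close> can only decrease
      as \<open>e m x\<close> grows, so they are eventually equal to their minimum.\<close>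
    define y where "y = (LEAST y. y \<in> range w)"
    have "y \<in> range w" unfolding y_def by (rule LeastI) auto
    then obtain M0 where M0: "w M0 = y" by auto
    have wy: "w m = y" if "M0 \<le> m" for m
    proof (rule antisym)
      have "P m y" using w[of M0] M0 gen_C_seq_mono[OF e that] by (auto simp: P_def)
      then show "w m \<le> y" unfolding w_def by (rule Least_le)
      show "y \<le> w m" unfolding y_def by (rule Least_le) auto
    qed
    have yx: "y < x" and dy: "d < y"
      using w[of M0] M0 e_club[of x M0] False unfolding P_def club_in_def seg_def
      by (auto simp: less_le)
    \<comment> \<open>As \<open>e m x\<close> is closed in \<open>x\<close> and omits
      \<open>d < x\<close>, it cannot accumulate at \<open>d\<close>.\<close>
    have "\<exists>s<d. \<forall>g\<in>e m x. g < d \<longrightarrow> g \<le> s" for m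
    proof -
      have "\<not> lim_pt (e m x) d"
        using e_club[of x m] less.prems False by (auto simp: club_in_def)
      with y0 show ?thesis unfolding lim_pt_def by (meson not_le)
    qed
    then obtain s where s: "\<And>m. s m < d" "\<And>m g. g \<in> e m x \<Longrightarrow> g < d \<Longrightarrow> g \<le> s m"
      by metis
    obtain s' where s': "s' < d" "\<And>m. s m < s'" using bnd[of s] s(1) by blast
    obtain M k b g where IH: "g < d" "d < b"
      "\<And>m. M \<le> m \<Longrightarrow> d \<in> e m b"
      "\<And>m z. M \<le> m \<Longrightarrow> g < z \<Longrightarrow> z < d \<Longrightarrow> walk e m z y k = b"
      using less.IH[OF yx dy] by blast
    \<comment> \<open>No point of \<open>e m x\<close> lies between \<open>s'\<close> and
      \<open>d\<close>, so such a target \<open>z\<close> has the same first step \<open>y\<close>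
      as \<open>d\<close>; the induction hypothesis for \<open>y\<close> does the rest.\<close>
    have "walk e m z x (Suc k) = b" if "max M0 M \<le> m" "max s' g < z" "z < d" for m z
    proof -
      have "(LEAST v. v \<in> e m x \<and> z \<le> v) = y"
      proof (rule Least_equality)
        show "y \<in> e m x \<and> z \<le> y"
          using w[of m] wy[of m] that dy by (auto simp: P_def)
        fix v assume v: "v \<in> e m x \<and> z \<le> v"
        have "\<not> v < d" using s(2)[of v m] s'(2)[of m] v that(2) by force
        with v have "P m v" by (simp add: P_def)
        then have "w m \<le> v" unfolding w_def by (rule Least_le)
        with wy[of m] that(1) show "y \<le> v" by simp
      qed
      moreover have "z < x" using that(3) less.prems by order
      ultimately have "walk e m z x 1 = y" by simp
      then show ?thesis using IH(4)[of m z] that unfolding walk_Suc_shift by simp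
    qed
    then show ?thesis using IH(1-3) s'(1)
      by (intro exI[of _ "max M0 M"] exI[of _ "Suc k"] exI[of _ b] exI[of _ "max s' g"]) auto
  qed
qed

section \<open>Covering \<open>nacc C\<close> by the intervals\<close>

text \<open>The least index \<open>h\<close> with \<open>a \<le> c d h\<close> is above
  \<open>u\<close>. It cannot be a limit: the supremum of the earlier \<open>c d g\<close> would lie
  below \<open>a\<close>, since \<open>a\<close> is not a limit of \<open>C\<close>, yet by
  closedness it would be some \<open>c d k\<close> with \<open>k \<ge> h\<close>.\<close>

lemma nacc_in_Ivl:
  fixes c :: "'a::wellorder \<Rightarrow> 'a \<Rightarrow> 'a"
  assumes mono: "strict_mono_on (seg sigma) (c d)"
    and c: "club_in d (c d ` seg sigma)"
    and C: "club_in d C" "c d ` seg sigma \<subseteq> C"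
    and a: "a \<in> nacc C" "u < sigma" "c d u < a"
  shows "\<exists>g<sigma. a \<in> Ivl c d g"
proof -
  have less: "c d g < c d h" if "g < h" "h < sigma" for g h
    using mono that by (auto simp: strict_mono_on_def seg_def)
  have ad: "a < d" and not_lim: "\<not> lim_pt C a" and aC: "a \<in> C"
    using a(1) C(1) by (auto simp: nacc_def club_in_def seg_def acc_def)
  define h where "h = (LEAST h. h < sigma \<and> a \<le> c d h)"
  have "\<exists>h. h < sigma \<and> a \<le> c d h" using c ad by (auto simp: club_in_def seg_def)
  then have h: "h < sigma \<and> a \<le> c d h" unfolding h_def by (rule LeastI_ex)
  have below: "c d g < a" if "g < h" for g
    using not_less_Least[of g "\<lambda>h. h < sigma \<and> a \<le> c d h"] that h
    unfolding h_def[symmetric] by auto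
  have uh: "u < h"
  proof (rule ccontr)
    assume "\<not> u < h"
    then have "c d h \<le> c d u" using less[of h u] a(2) by (cases "u = h") (auto simp: less_le)
    with h a(3) show False by auto
  qed
  show ?thesis
  \<comment> \<open>The distinction is whether \<open>h\<close> is a successor, with
    \<open>g\<close> its predecessor.\<close>
  proof (cases "\<exists>g<h. \<forall>k<h. k \<le> g")
    case True
    then obtain g where g: "g < h" "\<And>k. k < h \<Longrightarrow> k \<le> g" by blast
    have "osucc g = h" unfolding osucc_def
      by (rule Least_equality) (use g in \<open>auto simp: not_less[symmetric]\<close>)
    then show ?thesis using g(1) h below[OF g(1)]
      by (intro exI[of _ g]) (auto simp: Ivl_def)
  next
    case False
    then have next_pt: "\<exists>k<h. g < k" if "g < h" for g using that by (meson not_le)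
    have "c d u \<in> C" using C(2) a(2) by (auto simp: seg_def)
    with not_lim a(3) obtain b where b: "b < a" "\<And>g. g \<in> C \<Longrightarrow> b < g \<Longrightarrow> \<not> g < a"
      unfolding lim_pt_def by blast
    have le_b: "c d g \<le> b" if "g < h" for g
    proof -
      have "g < sigma" using that h by (meson less_trans)
      then have "c d g \<in> C" using C(2) by (auto simp: seg_def)
      then show ?thesis using b(2)[of "c d g"] below[OF that] by (meson not_le)
    qed
    define s where "s = (LEAST s. \<forall>g<h. c d g \<le> s)"
    have s: "\<forall>g<h. c d g \<le> s" unfolding s_def by (rule LeastI[of _ b]) (use le_b in blast)
    have sb: "s \<le> b" unfolding s_def by (rule Least_le) (use le_b in blast)
    have s_strict: "c d g < s" if gh: "g < h" for g
    proof -
      obtain k where k: "k < h" "g < k" using next_pt[OF gh] by blast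
      then have "c d g < c d k" using less h by (meson less_trans)
      moreover have "c d k \<le> s" using s k(1) by blast
      ultimately show ?thesis by simp
    qed
    have "lim_pt (c d ` seg sigma) s" unfolding lim_pt_def
    proof (intro conjI allI impI)
      show "\<exists>g\<in>c d ` seg sigma. g < s" using s_strict[OF uh] a(2) by (auto simp: seg_def)
      fix b' assume "b' < s"
      then have "\<not> (\<forall>g<h. c d g \<le> b')"
        using not_less_Least unfolding s_def by blast
      then obtain g where "g < h" "b' < c d g" by (auto simp: not_le)
      then show "\<exists>g\<in>c d ` seg sigma. b' < g \<and> g < s"
        using s_strict[of g] h by (intro bexI[of _ "c d g"]) (auto simp: seg_def)
    qed
    moreover have "s < d" using sb b(1) ad by simp
    ultimately have "s \<in> c d ` seg sigma" using c by (auto simp: club_in_def)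
    then obtain k where k: "k < sigma" "s = c d k" by (auto simp: seg_def)
    have "\<not> k < h" using s_strict[of k] k by auto
    then have "c d h \<le> s" using less[of h k] k by (cases "h = k") (auto simp: less_le)
    then show ?thesis using h sb b(1) by auto
  qed
qed

section \<open>Clubs in lambda, and lambda as a regular cardinal\<close>

text \<open>Iterating a choice of \<open>h\<close> omega times from \<open>b\<close> gives an
  increasing sequence whose supremum is a closure point, because \<open>F\<close> survives lowering
  \<open>g\<close> and raising \<open>h\<close>.\<close>

lemma club_closure_points:
  fixes F :: "'a::wellorder \<Rightarrow> 'a \<Rightarrow> bool"
  assumes bnd: "\<And>f::nat \<Rightarrow> 'a. \<exists>y. \<forall>n. f n < y"
    and F: "\<And>g. \<exists>h. F g h"
    and F_mono: "\<And>g g' h h'. g' \<le> g \<Longrightarrow> h \<le> h' \<Longrightarrow> F g h \<Longrightarrow> F g' h'"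
  shows "club {x. \<forall>g<x. F g x}"
  unfolding club_def
proof (intro conjI allI impI)
  fix b
  have "\<exists>h. g < h \<and> F g h" for g
  proof -
    obtain h where "F g h" using F by blast
    moreover obtain y where "g < y" using bnd[of "\<lambda>_. g"] by blast
    ultimately show ?thesis using F_mono[of g g h "max h y"]
      by (intro exI[of _ "max h y"]) (auto simp: less_max_iff_disj)
  qed
  then obtain f where f: "\<And>g. g < f g" "\<And>g. F g (f g)" by metis
  define s where "s n = (f ^^ n) b" for n
  define x where "x = (LEAST x. \<forall>n. s n < x)"
  have "\<exists>x. \<forall>n. s n < x" using bnd[of s] .
  then have x: "\<And>n. s n < x" unfolding x_def by (rule LeastI2_ex) blast
  have "F g x" if g: "g < x" for g
  proof -
    have "\<not> (\<forall>n. s n < g)" using g not_less_Least unfolding x_def by blast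
    then obtain n where n: "g \<le> s n" by (auto simp: not_less)
    have "F (s n) (s (Suc n))" using f(2) by (simp add: s_def)
    then show ?thesis using F_mono[OF n, of "s (Suc n)" x] x[of "Suc n"] by simp
  qed
  moreover have "b \<le> x" using x[of 0] by (simp add: s_def)
  ultimately show "\<exists>g\<in>{x. \<forall>g<x. F g x}. b \<le> g" by blast
next
  fix a assume a: "lim_pt {x. \<forall>g<x. F g x} a"
  have "F g a" if "g < a" for g
  proof -
    obtain h where "h \<in> {x. \<forall>g<x. F g x}" "g < h" "h < a"
      using a \<open>g < a\<close> unfolding lim_pt_def by meson
    then show ?thesis using F_mono[of g g h a] by simp
  qed
  then show "a \<in> {x. \<forall>g<x. F g x}" by blast
qed

text \<open>With a maximum, the type would be a segment plus one point, hence smaller than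
  itself.\<close>

lemma no_max_if_initial:
  fixes x :: "'a::wellorder"
  assumes "\<And>a::'a. |seg a| <o |UNIV :: 'a set|" "infinite (UNIV :: 'a set)"
  shows "\<exists>y. x < y"
proof (rule ccontr)
  assume "\<nexists>y. x < y"
  then have "UNIV = seg x \<union> {x}" by (auto simp: seg_def not_less order.order_iff_strict)
  moreover have "|seg x \<union> {x}| <o |UNIV :: 'a set|"
  proof (rule card_of_Un_ordLess_infinite[OF assms(2) assms(1)])
    have "\<not> |UNIV :: 'a set| \<le>o |{x}|" using assms(2) card_of_ordLeq_finite by blast
    then show "|{x}| <o |UNIV :: 'a set|"
      using ordLess_or_ordLeq card_of_Well_order by blast
  qed
  ultimately show False using ordLess_irreflexive by metis
qed

text \<open>Regularity of a successor cardinal: an unbounded sequence would make the type a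
  countable union of segments of size at most \<open>|M|\<close>.\<close>

lemma seq_bounded_UNIV:
  fixes f :: "nat \<Rightarrow> 'a::wellorder"
  assumes init: "\<And>a::'a. |seg a| <o |UNIV :: 'a set|"
    and succ: "|UNIV :: 'a set| =o cardSuc |M|"
    and M: "|UNIV :: nat set| \<le>o |M|"
  shows "\<exists>y. \<forall>n. f n < y"
proof (rule ccontr)
  assume unbdd: "\<not> ?thesis"
  have M_less: "|M| <o |UNIV :: 'a set|"
    using cardSuc_greater[OF card_of_Card_order] succ ordIso_symmetric ordLess_ordIso_trans
    by blast
  have infM: "infinite M" using M infinite_iff_card_of_nat by blast
  have "infinite (UNIV :: 'a set)"
    using M_less infM card_of_ordLeq_finite ordLess_imp_ordLeq by blast
  then have "\<forall>n. \<exists>y. f n < y" using no_max_if_initial[OF init] by blast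
  \<comment> \<open>Unboundedness gives only \<open>y \<le> f n\<close>, whereas \<open>seg\<close>
    is strict, hence the shift to \<open>h n\<close>.\<close>
  then obtain h where h: "\<And>n. f n < h n" by metis
  have "\<exists>n. y < h n" for y
    using unbdd h by (meson le_less_trans not_less)
  then have "UNIV = (\<Union>n. seg (h n))" by (auto simp: seg_def)
  moreover have "|\<Union>n. seg (h n)| \<le>o |M|"
  proof (rule card_of_UNION_ordLeq_infinite[OF infM M], rule ballI)
    fix n
    have "|seg (h n)| <o cardSuc |M|" using init succ ordLess_ordIso_trans by blast
    then show "|seg (h n)| \<le>o |M|"
      using cardSuc_ordLeq_ordLess[OF card_of_Card_order card_of_Card_order] by blast
  qed
  ultimately show False using M_less not_ordLess_ordLeq by metis
qed

text \<open>Otherwise every \<open>t a\<close> with \<open>a \<ge> g\<close> has a point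
  \<open>\<le> g\<close>. By disjointness the chosen points are distinct, so a set of full size
  would inject into a segment.\<close>

lemma disjoint_family_tail:
  fixes t :: "'a::wellorder \<Rightarrow> 'a set"
  assumes init: "\<And>a::'a. |seg a| <o |UNIV :: 'a set|"
    and inf: "infinite (UNIV :: 'a set)"
    and disj: "\<And>a b. a \<noteq> b \<Longrightarrow> t a \<inter> t b = {}"
  shows "\<exists>a\<ge>g. \<forall>x\<in>t a. g < x"
proof (rule ccontr)
  assume "\<not> ?thesis"
  moreover have "a \<ge> g" if "a \<in> - seg g" for a using that by (simp add: seg_def)
  ultimately have "\<forall>a\<in>- seg g. \<exists>x. x \<in> t a \<and> x \<le> g" by (meson not_less)
  from bchoice[OF this] obtain p where p: "\<And>a. a \<notin> seg g \<Longrightarrow> p a \<in> t a \<and> p a \<le> g"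
    by blast
  have "inj_on p (- seg g)"
    by (rule inj_onI) (use p disj in \<open>metis ComplD disjoint_iff\<close>)
  moreover obtain h where h: "g < h" using no_max_if_initial[OF init inf] by blast
  moreover have "p ` (- seg g) \<subseteq> seg h" using p h by (force simp: seg_def)
  ultimately have "|- seg g| \<le>o |seg h|" using card_of_ordLeq by blast
  then have "|- seg g| <o |UNIV :: 'a set|" using init ordLeq_ordLess_trans by blast
  then have "|seg g \<union> - seg g| <o |UNIV :: 'a set|"
    using inf init by (intro card_of_Un_ordLess_infinite)
  then show False by (simp add: ordLess_irreflexive)
qed

lemma not_lim_pt_if_small:
  assumes "|D| <o |seg (cf a)|"
  shows "\<not> lim_pt D a"
proof
  assume lim: "lim_pt D a"
  have "|D \<inter> seg a| <o |seg (cf a)|"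
    using assms card_of_mono1[of "D \<inter> seg a" D] ordLeq_ordLess_trans by blast
  then obtain y where "y < a" "\<forall>x\<in>D \<inter> seg a. x < y"
    using bounded_if_small[of "D \<inter> seg a" a] by blast
  with lim show False unfolding lim_pt_def seg_def by (blast dest: less_asym)
qed

text \<open>The seed \<open>y0\<close> keeps \<open>Max\<close> off the empty set, so
  \<open>T\<close> may be empty, and it adds a prescribed lower bound.\<close>

lemma bound_finite:
  fixes f :: "'b \<Rightarrow> 'a::linorder"
  assumes "finite T" "y0 < d" "\<And>x. x \<in> T \<Longrightarrow> f x < d"
  shows "\<exists>y<d. y0 \<le> y \<and> (\<forall>x\<in>T. f x \<le> y)"
proof -
  have "Max (insert y0 (f ` T)) < d" using assms by simp
  moreover have "y0 \<le> Max (insert y0 (f ` T))" using assms(1) by simp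
  moreover have "\<forall>x\<in>T. f x \<le> Max (insert y0 (f ` T))" using assms(1) by simp
  ultimately show ?thesis by blast
qed

theorem theorem6p1:
  fixes mu sigma :: "'a::wellorder"
    and mus :: "nat \<Rightarrow> 'a"
    and S :: "'a set"
    and c0 :: "'a \<Rightarrow> 'a \<Rightarrow> 'a"
    and C :: "'a \<Rightarrow> 'a set"
    and e :: "nat \<Rightarrow> 'a \<Rightarrow> 'a set"
    and t :: "'a \<Rightarrow> 'a set"
  assumes mu_card: "is_card mu"
    and mu_cf: "ordIso2 (card_of (seg (cf mu))) (card_of (UNIV :: nat set))"
    and lambda_succ: "ordIso2 (card_of (UNIV :: 'a set)) (cardSuc (card_of (seg mu)))"
    and lambda_initial: "\<forall>a::'a. ordLess2 (card_of (seg a)) (card_of (UNIV :: 'a set))"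
    and sigma_regular: "cf sigma = sigma"
    and sigma_uncountable: "\<not> ordLeq2 (card_of (seg sigma)) (card_of (UNIV :: nat set))"
    and sigma_mu: "sigma < mu"
    and mus_mono: "strict_mono mus"
    and mus_regular: "\<forall>i. cf (mus i) = mus i"
    and mus_below: "\<forall>i. mus i < mu"
    and mus_cofinal: "\<forall>b<mu. \<exists>i. b < mus i"
    and sigma_mus0: "sigma < mus 0"
    and S_cf: "S \<subseteq> {d. cf d = sigma}"
    and S_stat: "stationary S"
    and c0_enum: "\<forall>d\<in>S. strict_mono_on (seg sigma) (c0 d) \<and> club_in d (c0 d ` seg sigma)"
    and c0_guess: "\<forall>E. club E \<longrightarrow> stationary {d\<in>S. c0 d ` seg sigma \<subseteq> E}"
    and C_club: "\<forall>d\<in>S. club_in d (C d)"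
    and C_c0: "\<forall>d\<in>S. c0 d ` seg sigma \<subseteq> C d"
    and C_size: "\<forall>d\<in>S. \<forall>g<sigma.
                   ordLeq2 (card_of (C d \<inter> Ivl c0 d g)) (card_of (seg (csuc (mus (fin g)))))"
    and C_cf: "\<forall>d\<in>S. \<forall>g<sigma. \<forall>a\<in>nacc (C d) \<inter> Ivl c0 d g. csuc (mus (fin g)) < cf a"
    and C_guess: "\<forall>E. club E \<longrightarrow>
                    stationary {d\<in>S. \<forall>g<sigma. E \<inter> nacc (C d) \<inter> Ivl c0 d g \<noteq> {}}"
    and e_seq: "gen_C_seq e"
    and e_size: "\<forall>a m. ordLeq2 (card_of (e m a))
                         (card_of (seg (cf a) <+> seg (csuc (mus m))))"
    and e_C: "\<forall>a m d. d \<in> S \<inter> e m a \<longrightarrow> Cm sigma c0 C d m \<subseteq> e m a"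
    and t_fin: "\<forall>a. finite (t a)"
    and t_disj: "\<forall>a b. a \<noteq> b \<longrightarrow> t a \<inter> t b = {}"
  shows "{bs. \<not> (\<exists>a b m. a < b \<and>
              (\<forall>z\<in>t a. \<forall>x\<in>t b. z < x \<and> (\<exists>k. walk e m z x k = bs)))} \<in> idp mu S C"
proof -
  have init: "\<And>a::'a. |seg a| <o |UNIV :: 'a set|" using lambda_initial ..
  have nat_sigma: "|UNIV :: nat set| <o |seg sigma|"
    using sigma_uncountable ordLess_or_ordLeq[OF card_of_Well_order card_of_Well_order] by blast
  have nat_mu: "|UNIV :: nat set| <o |seg mu|"
    using ordLess_ordLeq_trans[OF nat_sigma seg_card_mono] sigma_mu by simp
  have small: "|seg a| \<le>o |seg mu|" for a :: 'a
    using ordLess_ordIso_trans[OF init lambda_succ]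
    by (simp add: cardSuc_ordLeq_ordLess card_of_Card_order)
  have bndU: "\<And>f::nat \<Rightarrow> 'a. \<exists>y. \<forall>n. f n < y"
    by (rule seq_bounded_UNIV[OF init lambda_succ ordLess_imp_ordLeq[OF nat_mu]])
  have inf_sigma: "infinite (seg sigma)"
    unfolding infinite_iff_card_of_nat by (rule ordLess_imp_ordLeq[OF nat_sigma])
  then have inf: "infinite (UNIV :: 'a set)" by (rule infinite_super[OF subset_UNIV])
  \<comment> \<open>The countable cofinality of \<open>mu\<close> enters here; it allows finitely
    many values \<open>cf (w x)\<close> to be bounded below \<open>mu\<close>.\<close>
  have cf_mu: "cf a < mu" for a :: 'a
    by (rule cf_less_if_countable_cofinality[where mus = mus, OF mu_card nat_mu _ _ small])
      (use mus_below mus_cofinal in blast)+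
  have mus_csuc: "|seg (mus i)| <o |seg (csuc (mus i))|" for i
    by (rule csuc_card[OF is_card_less[OF mu_card]]) (simp add: mus_below)
  \<comment> \<open>\<open>mus (Suc i)\<close> is a cardinal above \<open>mus i\<close>, so it
    bounds the successor.\<close>
  have csuc_less: "csuc (mus i) < mu" for i
  proof -
    have "is_card (mus (Suc i))" using is_card_cf[of "mus (Suc i)"] mus_regular by simp
    then have "|seg (mus i)| <o |seg (mus (Suc i))|"
      by (rule is_card_less) (simp add: strict_monoD[OF mus_mono])
    then show ?thesis using csuc_le mus_below by (meson le_less_trans)
  qed

  define F where "F g h \<longleftrightarrow> (\<exists>a<h. \<forall>x\<in>t a. g < x \<and> x < h)" for g h
  define E where "E = {x. \<forall>g<x. F g x}"
  have clubE: "club E" unfolding E_def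
  proof (rule club_closure_points[OF bndU])
    fix g
    obtain a where a: "\<forall>x\<in>t a. g < x" using disjoint_family_tail[OF init inf, of t] t_disj by blast
    obtain h where h: "Max (insert a (t a)) < h" using no_max_if_initial[OF init inf] by blast
    then have "a < h" "\<forall>x\<in>t a. x < h" using t_fin by auto
    then show "\<exists>h. F g h" using a unfolding F_def by blast
  next
    fix g g' h h' :: 'a
    assume "g' \<le> g" "h \<le> h'" "F g h"
    then show "F g' h'" unfolding F_def by (meson le_less_trans less_le_trans)
  qed
  define Bad where "Bad = {bs. \<not> (\<exists>a b m. a < b \<and>
              (\<forall>z\<in>t a. \<forall>x\<in>t b. z < x \<and> (\<exists>k. walk e m z x k = bs)))}"
  have "Bad \<inter> E \<inter> C d \<in> Id mu C d" if d: "d \<in> S" for d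
  proof -
    have cfd: "cf d = sigma" using S_cf d by blast
    have bnd: "\<And>f::nat \<Rightarrow> 'a. (\<And>n. f n < d) \<Longrightarrow> \<exists>y<d. \<forall>n. f n < y"
      using seq_bounded[of d] nat_sigma unfolding cfd by blast
    obtain u where u: "u < sigma" using inf_sigma by (auto simp: seg_def dest: infinite_imp_nonempty)
    have c0d: "strict_mono_on (seg sigma) (c0 d)" "club_in d (c0 d ` seg sigma)"
      using c0_enum d by auto
    have Cd: "club_in d (C d)" "c0 d ` seg sigma \<subseteq> C d" using C_club C_c0 d by auto
    have ud: "c0 d u < d" using c0d(2) u by (auto simp: club_in_def seg_def)
    \<comment> \<open>\<open>d \<le> b\<close> will give \<open>a < b\<close>, as the eventual
      \<open>a\<close> lies below \<open>d\<close>.\<close>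
    obtain b where b: "d \<le> b" "\<And>x. x \<in> t b \<Longrightarrow> d < x"
      using disjoint_family_tail[OF init inf, of t d] t_disj by blast
    have "\<forall>x\<in>t b. \<exists>M k b g. g < d \<and> d < b \<and>
        (\<forall>m\<ge>M. d \<in> e m b \<and> (\<forall>z. g < z \<and> z < d \<longrightarrow> walk e m z x k = b))"
      using walk_stabilizes[OF e_seq bnd ud] b(2) by blast
    then obtain M k w g where
      st: "\<And>x. x \<in> t b \<Longrightarrow> g x < d" "\<And>x. x \<in> t b \<Longrightarrow> d < w x"
        "\<And>x m. x \<in> t b \<Longrightarrow> M x \<le> m \<Longrightarrow> d \<in> e m (w x)"
        "\<And>x m z. x \<in> t b \<Longrightarrow> M x \<le> m \<Longrightarrow> g x < z \<Longrightarrow> z < d \<Longrightarrow> walk e m z x (k x) = w x"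
      by metis
    \<comment> \<open>Besides the thresholds \<open>g x\<close>, \<open>G\<close> dominates
      \<open>c0 d u\<close>, so that points of \<open>nacc (C d)\<close> above it fall into some
      interval.\<close>
    obtain G where G: "G < d" "c0 d u \<le> G" "\<And>x. x \<in> t b \<Longrightarrow> g x \<le> G"
      using bound_finite[of "t b" "c0 d u" d g] t_fin ud st(1) by blast
    obtain G' where G': "G < G'" "G' < d" using bnd[of "\<lambda>_. G"] G(1) by blast
    define N where "N = Max (insert 0 (M ` t b))"
    have N: "M x \<le> N" if "x \<in> t b" for x using that t_fin by (simp add: N_def)
    obtain A where A: "A < mu" "csuc (mus N) \<le> A" "\<And>x. x \<in> t b \<Longrightarrow> cf (w x) \<le> A"
      using bound_finite[of "t b" "csuc (mus N)" mu "\<lambda>x. cf (w x)"] t_fin csuc_less cf_mu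
      by blast
    obtain i where i: "A < mus i" using mus_cofinal A(1) by blast

    have not_Bad: "bs \<notin> Bad" if bs: "bs \<in> E" "bs \<in> C d" "bs \<notin> acc (C d)" "mus i \<le> cf bs" "G' \<le> bs" for bs
    proof -
      have bsd: "bs < d" using bs(2) Cd(1) by (auto simp: club_in_def seg_def)
      have nacc: "bs \<in> nacc (C d)" using bs by (simp add: nacc_def)
      obtain h where h: "h < sigma" "bs \<in> Ivl c0 d h"
        using nacc_in_Ivl[where c = c0, OF c0d Cd nacc u] G(2) G'(1) bs(5) by (meson le_less_trans less_le_trans)
      \<comment> \<open>\<open>m\<close> depends on \<open>bs\<close>, but \<open>A\<close> was
        fixed from \<open>N\<close> alone: if \<open>fin h\<close> exceeds \<open>N\<close>, the
        bound on \<open>csuc (mus m)\<close> comes from \<open>C_cf\<close>.\<close>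
      define m where "m = max N (fin h)"
      have "csuc (mus (fin h)) < cf bs" using C_cf d h nacc by blast
      moreover have "csuc (mus N) < cf bs" using A(2) i bs(4) by order
      ultimately have csuc: "csuc (mus m) < cf bs" by (simp add: m_def max_def)
      have "\<exists>y<bs. \<forall>v\<in>e m (w x). v < bs \<longrightarrow> v \<le> y" and mem: "bs \<in> e m (w x)"
        if x: "x \<in> t b" for x
      proof -
        have "cf (w x) < cf bs" using A(3)[OF x] i bs(4) by order
        then have "|seg (cf (w x))| <o |seg (cf bs)|" "|seg (csuc (mus m))| <o |seg (cf bs)|"
          using csuc is_card_less[OF is_card_cf] by blast+
        \<comment> \<open>This makes \<open>cf bs\<close> infinite, so a sum of two smaller
          cardinals stays below it.\<close>
        moreover have "sigma \<le> cf bs"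
        proof -
          have "mus 0 \<le> mus i" using mus_mono by (simp add: strict_mono_less_eq)
          then show ?thesis using sigma_mus0 bs(4) by order
        qed
        then have "infinite (seg (cf bs))" using inf_sigma seg_mono finite_subset by blast
        ultimately have "|seg (cf (w x)) <+> seg (csuc (mus m))| <o |seg (cf bs)|"
          by (intro card_of_Plus_ordLess_infinite)
        then have "\<not> lim_pt (e m (w x)) bs"
          using e_size ordLeq_ordLess_trans by (intro not_lim_pt_if_small) blast
        then show "\<exists>y<bs. \<forall>v\<in>e m (w x). v < bs \<longrightarrow> v \<le> y"
          using G'(1) bs(5) unfolding lim_pt_def by (meson less_le_trans not_le)
        have "d \<in> e m (w x)" using st(3)[OF x] N[OF x] by (simp add: m_def)
        then have "Cm sigma c0 C d m \<subseteq> e m (w x)" using e_C d by blast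
        moreover have "bs \<in> Cm sigma c0 C d m"
        proof -
          have "fin h \<le> m" by (simp add: m_def)
          then show ?thesis unfolding Cm_def using h bs(2) by blast
        qed
        ultimately show "bs \<in> e m (w x)" by blast
      qed
      then obtain y where y: "\<And>x. x \<in> t b \<Longrightarrow> y x < bs"
        "\<And>x v. x \<in> t b \<Longrightarrow> v \<in> e m (w x) \<Longrightarrow> v < bs \<Longrightarrow> v \<le> y x" by metis
      have "G < bs" using G'(1) bs(5) by order
      then obtain Y where Y: "Y < bs" "G \<le> Y" "\<And>x. x \<in> t b \<Longrightarrow> y x \<le> Y"
        using bound_finite[of "t b" G bs y] t_fin y(1) by blast
      obtain a where a: "a < bs" "\<And>z. z \<in> t a \<Longrightarrow> Y < z \<and> z < bs"
        using bs(1) Y(1) unfolding E_def F_def by blast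
      have "z < x \<and> walk e m z x (Suc (k x)) = bs" if z: "z \<in> t a" and x: "x \<in> t b" for z x
      proof -
        have zb: "Y < z" "z < bs" using a(2)[OF z] by auto
        have wk: "walk e m z x (k x) = w x"
          by (rule st(4)[OF x]) (use N[OF x] zb G(3)[OF x] Y(2) bsd in \<open>auto simp: m_def\<close>)
        \<comment> \<open>Points of \<open>e m (w x)\<close> below \<open>bs\<close> are at most
          \<open>Y\<close>, hence below \<open>z\<close>.\<close>
        have "(LEAST v. v \<in> e m (w x) \<and> z \<le> v) = bs"
        proof (rule Least_equality)
          show "bs \<in> e m (w x) \<and> z \<le> bs" using mem[OF x] zb by simp
          fix v assume "v \<in> e m (w x) \<and> z \<le> v"
          then show "bs \<le> v" using y(2)[OF x, of v] Y(3)[OF x] zb by force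
        qed
        moreover have "z < w x" using zb bsd st(2)[OF x] by order
        ultimately show ?thesis using wk zb bsd b(2)[OF x] by auto
      qed
      moreover have "a < b" using a(1) bsd b(1) by order
      ultimately have "\<exists>a b m. a < b \<and>
          (\<forall>z\<in>t a. \<forall>x\<in>t b. z < x \<and> (\<exists>k. walk e m z x k = bs))"
        by (intro exI[of _ a] exI[of _ b] exI[of _ m]) blast
      then show ?thesis by (simp add: Bad_def)
    qed
    have sub: "Bad \<inter> E \<inter> C d \<subseteq> {g \<in> C d. g \<in> acc (C d) \<or> cf g < mus i \<or> g < G'}"
      (is "_ \<subseteq> ?B")
    proof
      fix v assume v: "v \<in> Bad \<inter> E \<inter> C d"
      show "v \<in> ?B"
      proof (rule ccontr)
        assume "v \<notin> ?B"
        with v have "v \<notin> acc (C d)" "mus i \<le> cf v" "G' \<le> v" by (simp_all add: not_less)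
        with not_Bad[of v] v show False by simp
      qed
    qed
    show ?thesis unfolding Id_def gen_ideal_def
    \<comment> \<open>A single generator suffices, with parameters \<open>mus i\<close> and
      \<open>G'\<close>.\<close>
    proof (intro CollectI conjI exI[of _ "{?B}"])
      show "Bad \<inter> E \<inter> C d \<subseteq> C d" by (rule Int_lower2)
      show "{?B} \<subseteq> {{g \<in> C d. g \<in> acc (C d) \<or> cf g < a \<or> g < b} | a b. a < mu \<and> b < d}"
        using mus_below G'(2) by blast
      show "Bad \<inter> E \<inter> C d \<subseteq> \<Union> {?B}" using sub by simp
    qed simp
  qed
  with clubE show ?thesis unfolding idp_def Bad_def[symmetric] by blast
qed

end
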